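(* Let $(\mathfrak m,V,\omega,B_\mu)$ be a special symplectic representation over $k$. (i) Let $A\in V$ with $Q(A)\neq 0$. Then $$\mu^{-1}(\mu(A))=\{xA+y\Psi(A): x,y\in k,\ x^2-Q(A)y^2=1\}.$$ (ii) If $A\in V$ and $Q(A)\in{k^*}^2$, and $A=B+C$ with $B,C\in V$, $\mu(B)=\mu(C)=0$ and $\omega(B,C)\neq0$, then $$\mu^{-1}(\mu(A))=\Bigl\{uB+\tfrac1uC: u\in k^*\Bigr\}.$$ (iii) Let $\lambda\in k^*\setminus{k^*}^2$ and let $A\in V$ with $Q(A)\in\lambda{k^*}^2$. Let $k'$ be a splitting field of $x^2-\lambda$ and let $(\mathfrak m',V',\omega',B_\mu')$ be the base extension of the SSR to $k'$. If $A=B+\overline B$ with $B\in V'$, $\mu'(B)=0$ and $\omega'(B,\overline B)\neq 0$, then $$\mu^{-1}(\mu(A))=\Bigl\{zB+\tfrac1z\overline B: z\in k' \text{ such that } z\bar z=1\Bigr\}.$$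
   Context: $k$ is a field of characteristic not $2$ or $3$; $V$ is finite-dimensional. $k^*=k\setminus\{0\}$, ${k^*}^2=\{x^2:x\in k^*\}$. A special symplectic representation (SSR) $(\mathfrak m,V,\omega,B_\mu)$ over $k$ is a faithful representation of a Lie algebra $\mathfrak m$ over $k$ on a symplectic vector space $(V,\omega)$ ($\omega$ a nondegenerate alternating bilinear form), together with an $\mathfrak m$-equivariant symmetric bilinear map $B_\mu:V\times V\to\mathfrak m$ (equivariance: $[m,B_\mu(A,B)]=B_\mu(m\cdot A,B)+B_\mu(A,m\cdot B)$), such that for all $m\in\mathfrak m$ and $A,B,C\in V$: $$\omega(m\cdot A,B)+\omega(A,m\cdot B)=0,$$ $$2B_\mu(A,B)\cdot C-2B_\mu(A,C)\cdot B=2\omega(B,C)A-\omega(A,B)C+\omega(A,C)B.$$ Covariants: $\mu(A)=B_\mu(A,A)\in\mathfrak m$, $\Psi(A)=\mu(A)\cdot A\in V$, $Q(A)=\frac32\,\omega(A,\Psi(A))\in k$. Here $\mu^{-1}(\mu(A))$ denotes $\{A'\in V:\mu(A')=\mu(A)\}$. For a quadratic extension $k'/k$ (Galois since the characteristic is not 2) the generator of $\mathrm{Gal}(k'/k)\cong\mathbb Z/2$ acts on $k'$ and on $W'=W\otimes_kk'$ for any $k$-vector space $W$ (through the second factor); this action is written $w\mapsto\overline w$. $\mu'$ is the quadratic covariant $\mu'(v)=B'_\mu(v,v)$ of the base extension. $V$ is viewed as a subset of $V'$. *)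

theory Defs
  imports
    "HOL-Library.Poly_Mapping"
    "HOL-Computational_Algebra.Polynomial"
begin

section \<open>Lie algebras and special symplectic representations\<close>

definition bilinear_over ::
    "('k::field \<Rightarrow> 'a::ab_group_add \<Rightarrow> 'a) \<Rightarrow> ('k \<Rightarrow> 'b::ab_group_add \<Rightarrow> 'b) \<Rightarrow>
     ('k \<Rightarrow> 'c::ab_group_add \<Rightarrow> 'c) \<Rightarrow> ('a \<Rightarrow> 'b \<Rightarrow> 'c) \<Rightarrow> bool" where
  "bilinear_over s1 s2 s3 f \<longleftrightarrow>
     (\<forall>x. Vector_Spaces.linear s2 s3 (f x)) \<and>
     (\<forall>y. Vector_Spaces.linear s1 s3 (\<lambda>x. f x y))"

locale lie_algebra = vector_space scale
  for scale :: "'k::field \<Rightarrow> 'm::ab_group_add \<Rightarrow> 'm" +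
  fixes bracket :: "'m \<Rightarrow> 'm \<Rightarrow> 'm"
  assumes bracket_bilinear: "bilinear_over scale scale scale bracket"
    and bracket_alternating: "bracket x x = 0"
    and jacobi: "bracket x (bracket y z) + bracket y (bracket z x) + bracket z (bracket x y) = 0"

locale faithful_lie_representation =
  M: lie_algebra scale_m bracket + V: vector_space scale_V
  for scale_m :: "'k::field \<Rightarrow> 'm::ab_group_add \<Rightarrow> 'm"
    and bracket :: "'m \<Rightarrow> 'm \<Rightarrow> 'm"
    and scale_V :: "'k \<Rightarrow> 'v::ab_group_add \<Rightarrow> 'v" +
  fixes act :: "'m \<Rightarrow> 'v \<Rightarrow> 'v"
  assumes act_bilinear: "bilinear_over scale_m scale_V scale_V act"
    and act_bracket: "act (bracket m n) A = act m (act n A) - act n (act m A)"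
    and act_faithful: "act m = act n \<Longrightarrow> m = n"

locale symplectic_space = vector_space scale
  for scale :: "'k::field \<Rightarrow> 'v::ab_group_add \<Rightarrow> 'v" +
  fixes \<omega> :: "'v \<Rightarrow> 'v \<Rightarrow> 'k"
  assumes form_bilinear: "bilinear_over scale scale (*) \<omega>"
    and form_alternating: "\<omega> A A = 0"
    and form_nondegenerate: "(\<And>B. \<omega> A B = 0) \<Longrightarrow> A = 0"

locale special_symplectic_representation =
  faithful_lie_representation scale_m bracket scale_V act + symplectic_space scale_V \<omega>
  for scale_m :: "'k::field \<Rightarrow> 'm::ab_group_add \<Rightarrow> 'm"
    and bracket :: "'m \<Rightarrow> 'm \<Rightarrow> 'm"
    and scale_V :: "'k \<Rightarrow> 'v::ab_group_add \<Rightarrow> 'v"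
    and act :: "'m \<Rightarrow> 'v \<Rightarrow> 'v"
    and \<omega> :: "'v \<Rightarrow> 'v \<Rightarrow> 'k" +
  fixes B\<mu> :: "'v \<Rightarrow> 'v \<Rightarrow> 'm"
  assumes finite_dim: "\<exists>Basis. finite_dimensional_vector_space scale_V Basis"
    and B_bilinear: "bilinear_over scale_V scale_V scale_m B\<mu>"
    and B_symmetric: "B\<mu> A B = B\<mu> B A"
    and B_equivariant: "bracket m (B\<mu> A B) = B\<mu> (act m A) B + B\<mu> A (act m B)"
    and form_invariant: "\<omega> (act m A) B + \<omega> A (act m B) = 0"
    and special:
      "scale_V 2 (act (B\<mu> A B) C) - scale_V 2 (act (B\<mu> A C) B) =
       scale_V (2 * \<omega> B C) A - scale_V (\<omega> A B) C + scale_V (\<omega> A C) B"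

definition mu :: "('v \<Rightarrow> 'v \<Rightarrow> 'm) \<Rightarrow> 'v \<Rightarrow> 'm" where
  "mu B\<mu> A = B\<mu> A A"

definition Psi :: "('m \<Rightarrow> 'v \<Rightarrow> 'v) \<Rightarrow> ('v \<Rightarrow> 'v \<Rightarrow> 'm) \<Rightarrow> 'v \<Rightarrow> 'v" where
  "Psi act B\<mu> A = act (mu B\<mu> A) A"

definition Qcov ::
    "('m \<Rightarrow> 'v \<Rightarrow> 'v) \<Rightarrow> ('v \<Rightarrow> 'v \<Rightarrow> 'k::field) \<Rightarrow> ('v \<Rightarrow> 'v \<Rightarrow> 'm) \<Rightarrow> 'v \<Rightarrow> 'k" where
  "Qcov act \<omega> B\<mu> A = 3 / 2 * \<omega> A (Psi act B\<mu> A)"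

text \<open>The set of squares of nonzero scalars.\<close>

definition unit_squares :: "'k::field set" where
  "unit_squares = {x\<^sup>2 | x. x \<noteq> 0}"

section \<open>Splitting fields and their Galois groups\<close>

definition ring_homomorphism :: "('a::field \<Rightarrow> 'b::field) \<Rightarrow> bool" where
  "ring_homomorphism f \<longleftrightarrow> f 1 = 1 \<and> (\<forall>x y. f (x + y) = f x + f y \<and> f (x * y) = f x * f y)"

definition is_subfield :: "'a::field set \<Rightarrow> bool" where
  "is_subfield F \<longleftrightarrow>
     1 \<in> F \<and> (\<forall>x\<in>F. \<forall>y\<in>F. x - y \<in> F \<and> x * y \<in> F) \<and> (\<forall>x\<in>F. inverse x \<in> F)"

text \<open>The field \<open>'l\<close>, regarded as an extension of \<open>'k\<close> through \<open>\<iota>\<close>, is a splitting field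
  of \<open>p\<close>.\<close>

definition splitting_field :: "('k::field \<Rightarrow> 'l::field) \<Rightarrow> 'k poly \<Rightarrow> bool" where
  "splitting_field \<iota> p \<longleftrightarrow>
     ring_homomorphism \<iota> \<and>
     (\<exists>c rs. map_poly \<iota> p = smult c (\<Prod>r\<leftarrow>rs. [:- r, 1:])) \<and>
     (\<forall>F. is_subfield F \<and> range \<iota> \<subseteq> F \<and> {r. poly (map_poly \<iota> p) r = 0} \<subseteq> F \<longrightarrow> F = UNIV)"

definition galois_group :: "('k::field \<Rightarrow> 'l::field) \<Rightarrow> ('l \<Rightarrow> 'l) set" where
  "galois_group \<iota> = {\<sigma>. ring_homomorphism \<sigma> \<and> bij \<sigma> \<and> (\<forall>x. \<sigma> (\<iota> x) = \<iota> x)}"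

text \<open>Only finite Galois groups are considered, so nonnegative powers suffice.\<close>

definition galois_generator :: "('k::field \<Rightarrow> 'l::field) \<Rightarrow> ('l \<Rightarrow> 'l) \<Rightarrow> bool" where
  "galois_generator \<iota> \<sigma> \<longleftrightarrow>
     \<sigma> \<in> galois_group \<iota> \<and> (\<forall>\<tau>\<in>galois_group \<iota>. \<exists>n::nat. \<tau> = \<sigma> ^^ n)"

section \<open>Tensor products\<close>

text \<open>The tensor product of \<open>V\<close> and \<open>W\<close> over \<open>'k\<close> is the free vector space on \<open>V \<times> W\<close> modulo the
  subspace spanned by the usual relations. Since that subspace depends on the scalar
  multiplications, the quotient is not a type; instead, \<open>tensor_product\<close> says that the linear
  map from the free vector space to \<open>T\<close> that sends the generator \<open>(v, w)\<close> to \<open>t v w\<close> induces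
  an isomorphism from this quotient onto \<open>T\<close>.\<close>

definition free_scale :: "'k::field \<Rightarrow> ('a \<Rightarrow>\<^sub>0 'k) \<Rightarrow> ('a \<Rightarrow>\<^sub>0 'k)" where
  "free_scale c f = Poly_Mapping.map ((*) c) f"

definition free_lift ::
    "('k::field \<Rightarrow> 't::ab_group_add \<Rightarrow> 't) \<Rightarrow> ('a \<Rightarrow> 't) \<Rightarrow> ('a \<Rightarrow>\<^sub>0 'k) \<Rightarrow> 't" where
  "free_lift s g f = (\<Sum>a\<in>Poly_Mapping.keys f. s (Poly_Mapping.lookup f a) (g a))"

definition tensor_relations ::
    "('k::field \<Rightarrow> 'v::ab_group_add \<Rightarrow> 'v) \<Rightarrow> ('k \<Rightarrow> 'w::ab_group_add \<Rightarrow> 'w) \<Rightarrow>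
     ('v \<times> 'w \<Rightarrow>\<^sub>0 'k) set" where
  "tensor_relations s1 s2 =
     (let e = (\<lambda>v w. Poly_Mapping.single (v, w) 1) in
       {e (v + v') w - e v w - e v' w | v v' w. True} \<union>
       {e v (w + w') - e v w - e v w' | v w w'. True} \<union>
       {e (s1 c v) w - free_scale c (e v w) | c v w. True} \<union>
       {e v (s2 c w) - free_scale c (e v w) | c v w. True})"

locale tensor_product =
  vector_space s1 + W: vector_space s2 + T: vector_space s3
  for s1 :: "'k::field \<Rightarrow> 'v::ab_group_add \<Rightarrow> 'v"
    and s2 :: "'k \<Rightarrow> 'w::ab_group_add \<Rightarrow> 'w"
    and s3 :: "'k \<Rightarrow> 't::ab_group_add \<Rightarrow> 't" +
  fixes t :: "'v \<Rightarrow> 'w \<Rightarrow> 't"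
  assumes surjective: "surj (free_lift s3 (\<lambda>(v, w). t v w))"
    and kernel:
      "{f. free_lift s3 (\<lambda>(v, w). t v w) f = 0} =
       module.span free_scale (tensor_relations s1 s2)"

section \<open>Base extension\<close>

text \<open>\<open>V'\<close> with scalar multiplication \<open>s'\<close> is the \<open>'l\<close>-vector space \<open>V \<otimes> 'l\<close>, where \<open>t v z\<close> is
  the pure tensor of \<open>v\<close> and \<open>z\<close>. The space \<open>V\<close> is embedded into it by \<open>v \<mapsto> t v 1\<close>.\<close>

locale space_base_extension =
  tensor_product s "\<lambda>c z. \<iota> c * z" "\<lambda>c. s' (\<iota> c)" t + E: vector_space s'
  for \<iota> :: "'k::field \<Rightarrow> 'l::field"
    and s :: "'k \<Rightarrow> 'v::ab_group_add \<Rightarrow> 'v"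
    and s' :: "'l \<Rightarrow> 'w::ab_group_add \<Rightarrow> 'w"
    and t :: "'v \<Rightarrow> 'l \<Rightarrow> 'w" +
  assumes hom: "ring_homomorphism \<iota>"
    and scale_pure: "s' z (t v y) = t v (z * y)"

text \<open>The primed operations are the \<open>'l\<close>-bilinear extensions of the unprimed ones; here
  \<open>t\<^sub>m\<close> and \<open>t\<^sub>V\<close> form pure tensors in the extended Lie algebra and in the extended
  representation space.\<close>

locale ssr_base_extension =
  special_symplectic_representation scale_m bracket scale_V act \<omega> B\<mu> +
  m_ext: space_base_extension \<iota> scale_m scale_m' t\<^sub>m +
  V_ext: space_base_extension \<iota> scale_V scale_V' t\<^sub>V
  for scale_m :: "'k::field \<Rightarrow> 'm::ab_group_add \<Rightarrow> 'm"
    and bracket :: "'m \<Rightarrow> 'm \<Rightarrow> 'm"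
    and scale_V :: "'k \<Rightarrow> 'v::ab_group_add \<Rightarrow> 'v"
    and act :: "'m \<Rightarrow> 'v \<Rightarrow> 'v"
    and \<omega> :: "'v \<Rightarrow> 'v \<Rightarrow> 'k"
    and B\<mu> :: "'v \<Rightarrow> 'v \<Rightarrow> 'm"
    and \<iota> :: "'k \<Rightarrow> 'l::field"
    and t\<^sub>m :: "'m \<Rightarrow> 'l \<Rightarrow> 'n::ab_group_add"
    and t\<^sub>V :: "'v \<Rightarrow> 'l \<Rightarrow> 'w::ab_group_add"
    and scale_m' :: "'l \<Rightarrow> 'n \<Rightarrow> 'n"
    and bracket' :: "'n \<Rightarrow> 'n \<Rightarrow> 'n"
    and scale_V' :: "'l \<Rightarrow> 'w \<Rightarrow> 'w"
    and act' :: "'n \<Rightarrow> 'w \<Rightarrow> 'w"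
    and \<omega>' :: "'w \<Rightarrow> 'w \<Rightarrow> 'l"
    and B\<mu>' :: "'w \<Rightarrow> 'w \<Rightarrow> 'n" +
  assumes bracket_ext_bilinear: "bilinear_over scale_m' scale_m' scale_m' bracket'"
    and bracket_ext: "bracket' (t\<^sub>m m x) (t\<^sub>m n y) = t\<^sub>m (bracket m n) (x * y)"
    and act_ext_bilinear: "bilinear_over scale_m' scale_V' scale_V' act'"
    and act_ext: "act' (t\<^sub>m m x) (t\<^sub>V A y) = t\<^sub>V (act m A) (x * y)"
    and form_ext_bilinear: "bilinear_over scale_V' scale_V' (*) \<omega>'"
    and form_ext: "\<omega>' (t\<^sub>V A x) (t\<^sub>V B y) = \<iota> (\<omega> A B) * (x * y)"
    and B_ext_bilinear: "bilinear_over scale_V' scale_V' scale_m' B\<mu>'"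
    and B_ext: "B\<mu>' (t\<^sub>V A x) (t\<^sub>V B y) = t\<^sub>m (B\<mu> A B) (x * y)"

text \<open>\<open>\<kappa>\<close> is the action of \<open>\<sigma>\<close> on a base extension through the second tensor factor.\<close>

definition conjugation ::
    "('v \<Rightarrow> 'l \<Rightarrow> 'w::ab_group_add) \<Rightarrow> ('l \<Rightarrow> 'l) \<Rightarrow> ('w \<Rightarrow> 'w) \<Rightarrow> bool" where
  "conjugation t \<sigma> \<kappa> \<longleftrightarrow>
     (\<forall>x y. \<kappa> (x + y) = \<kappa> x + \<kappa> y) \<and> (\<forall>v z. \<kappa> (t v z) = t v (\<sigma> z))"

end

theory Submission
  imports Defs
begin

text \<open>
  Fix \<open>A\<close> and write \<open>m\<close>, \<open>\<Psi>\<close>, \<open>Q\<close> for \<open>\<mu>(A)\<close>, \<open>\<Psi>(A)\<close>, \<open>Q(A)\<close>. Since \<open>[m, m] = 0\<close>, equivariance of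
  \<open>\<mu>\<close> makes \<open>A\<close> and \<open>\<Psi>\<close> orthogonal for \<open>B\<^sub>\<mu>\<close>; together with the special identity this gives
  \<open>m \<Psi> = Q A\<close> and \<open>\<mu>(\<Psi>) = - Q m\<close>, so \<open>\<mu>(x A + y \<Psi>) = (x\<^sup>2 - Q y\<^sup>2) m\<close> on the plane of \<open>A\<close> and
  \<open>\<Psi>\<close> (\<open>mu_pencil\<close>). The points of norm one in that plane therefore lie in the fibre of \<open>\<mu>\<close>
  through \<open>A\<close>. For the converse, let \<open>\<mu>(A') = m\<close>.
    \<^item> \<open>Q(A') = Q\<close>, because \<open>B\<^sub>\<mu>(A, A')\<close> is skew for \<open>\<omega>\<close> and sends \<open>A\<close> to \<open>\<Psi>(A')\<close> and \<open>A'\<close>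
      to \<open>\<Psi>\<close>, up to multiples of \<open>A\<close> and \<open>A'\<close> respectively (\<open>Qcov_eq_if_mu_eq\<close>). Hence \<open>m\<^sup>2 A' = Q A'\<close>.
    \<^item> The operator \<open>9 m\<^sup>2 - Q\<close> maps all of \<open>V\<close> into the plane (\<open>act_mu_squared\<close>): for
      \<open>Q \<noteq> 0\<close> the eigenvalues of \<open>m\<^sup>2\<close> are \<open>Q\<close> on the plane and \<open>Q / 9\<close> on its \<open>\<omega>\<close>-complement. Hence \<open>8 Q A'\<close>,
      and so \<open>A'\<close>, lies in the plane.
  Every step is an identity over the ground field; no eigenvectors are chosen, and comparing
  \<open>Q(A')\<close> with \<open>Q\<close> through the form works in characteristic 5 too, where a comparison
  of the eigenvalues \<open>Q\<close> and \<open>Q / 9\<close> alone would not settle the matter.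

  The other two descriptions only change coordinates on the conic \<open>x\<^sup>2 - Q y\<^sup>2 = 1\<close>. If
  \<open>A = B + C\<close> with \<open>\<mu>(B) = \<mu>(C) = 0\<close>, then \<open>\<Psi>\<close> is a multiple of \<open>C - B\<close> and \<open>Q = 9 \<omega>(B, C)\<^sup>2\<close>,
  so the norm form factors (\<open>mu_fibre_split\<close>). For a decomposition over
  \<open>k' = k(\<delta>)\<close>, \<open>\<delta>\<^sup>2 = c\<close>, every vector of \<open>V'\<close> is \<open>P + \<delta> R\<close> with unique \<open>P, R \<in> V\<close>. In these terms
  \<open>A = B + \<kappa> B\<close> and \<open>\<mu>'(B) = 0\<close> say that \<open>P = A / 2\<close>, \<open>B\<^sub>\<mu>(A, R) = 0\<close> and \<open>m = - 4 c \<mu>(R)\<close>. Then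
  \<open>\<Psi>\<close> is a multiple of \<open>R\<close>, and \<open>z B + (1/z) \<kappa> B\<close> with \<open>z\<close> of norm one runs over the same conic
  (\<open>mu_fibre_conjugate\<close>).
\<close>

section \<open>Bilinear maps and the characteristic\<close>

lemma bilinear_overD:
  assumes "bilinear_over s1 s2 s3 f"
  shows "f (x + x') y = f x y + f x' y" and "f x (y + y') = f x y + f x y'"
    and "f (s1 c x) y = s3 c (f x y)" and "f x (s2 c y) = s3 c (f x y)"
  using assms by (simp_all add: bilinear_over_def Vector_Spaces.linear_iff)

lemma numerals_nonzero_if_char:
  assumes "CHAR('k::field) \<noteq> 2" "CHAR('k) \<noteq> 3"
  shows "(2 :: 'k) \<noteq> 0" "(3 :: 'k) \<noteq> 0"
proof -
  have *: "CHAR('k) dvd p \<Longrightarrow> CHAR('k) = p" if "prime p" for p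
    using that CHAR_not_1[where 'a = 'k] by (auto simp: prime_nat_iff)
  show "(2 :: 'k) \<noteq> 0"
    using *[of 2] assms of_nat_eq_0_iff_char_dvd[of 2, where 'a = 'k] by auto
  show "(3 :: 'k) \<noteq> 0"
    using *[of 3] assms of_nat_eq_0_iff_char_dvd[of 3, where 'a = 'k] by auto
qed

section \<open>Identities for the covariants\<close>

context special_symplectic_representation
begin

lemmas act_simps = bilinear_overD[OF act_bilinear]
lemmas B_simps = bilinear_overD[OF B_bilinear]
lemmas form_simps = bilinear_overD[OF form_bilinear]
lemmas bracket_simps = bilinear_overD[OF M.bracket_bilinear]

lemma act_zero [simp]: "act 0 A = 0"
  using act_simps(3)[of 0 0 A] by simp

lemma form_antisym: "\<omega> B A = - \<omega> A B"
proof -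
  have "\<omega> (A + B) (A + B) = \<omega> B A + \<omega> A B"
    by (simp only: form_simps) (simp add: form_alternating)
  then show ?thesis by (simp add: form_alternating eq_neg_iff_add_eq_0)
qed

lemma bracket_antisym: "bracket n m = - bracket m n"
proof -
  have "bracket (m + n) (m + n) = bracket n m + bracket m n"
    by (simp only: bracket_simps) (simp add: M.bracket_alternating)
  then show ?thesis by (simp add: M.bracket_alternating eq_neg_iff_add_eq_0)
qed

lemma form_skew: "\<omega> A (act m B) = - \<omega> (act m A) B"
  using form_invariant[of m A B] by (simp add: eq_neg_iff_add_eq_0 add.commute)

text \<open>The derivative of the quadratic map \<open>\<mu>\<close> along the action of \<open>m\<close>.\<close>

lemma bracket_mu: "bracket m (mu B\<mu> A) = scale_m 2 (B\<mu> (act m A) A)"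
  using M.scale_left_distrib[of 1 1 "B\<mu> (act m A) A"]
  by (simp add: mu_def B_equivariant B_symmetric)

context
  assumes two: "(2 :: 'k) \<noteq> 0"
begin

lemma special_halved:
  "act (B\<mu> A B) C = act (B\<mu> A C) B + scale_V (\<omega> B C) A
     - scale_V (\<omega> A B / 2) C + scale_V (\<omega> A C / 2) B"
proof -
  have "act (B\<mu> A B) C - act (B\<mu> A C) B
      = scale_V (1/2) (scale_V 2 (act (B\<mu> A B) C) - scale_V 2 (act (B\<mu> A C) B))"
    using two by (simp add: V.scale_right_diff_distrib)
  also have "\<dots> = scale_V (\<omega> B C) A - scale_V (\<omega> A B / 2) C + scale_V (\<omega> A C / 2) B"
    unfolding special using two
    by (simp add: V.scale_right_diff_distrib V.scale_right_distrib)
  finally show ?thesis by (simp add: algebra_simps)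
qed

text \<open>The special identity with its first two arguments equal; the right-hand side is the form in
  which the action of \<open>\<mu>(A)\<close> is computed from here on.\<close>

lemma act_mu: "act (mu B\<mu> A) C = act (B\<mu> A C) A + scale_V (3/2 * \<omega> A C) A"
proof -
  have "scale_V (3/2 * \<omega> A C) A = scale_V (\<omega> A C) A + scale_V (\<omega> A C / 2) A"
    using two by (simp flip: V.scale_left_distrib add: field_simps)
  then show ?thesis
    using special_halved[of A A C] by (simp add: mu_def form_alternating)
qed

text \<open>By equivariance, \<open>2 B\<^sub>\<mu>(\<Psi>(A), A)\<close> is the bracket of \<open>\<mu>(A)\<close> with itself.\<close>

lemma B_Psi: "B\<mu> (Psi act B\<mu> A) A = 0"
proof -
  have "scale_m 2 (B\<mu> (Psi act B\<mu> A) A) = 0"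
    using bracket_mu[of "mu B\<mu> A" A] M.bracket_alternating by (simp add: Psi_def)
  then show ?thesis using two by simp
qed

lemma act_mu_Psi: "act (mu B\<mu> A) (Psi act B\<mu> A) = scale_V (Qcov act \<omega> B\<mu> A) A"
  using act_mu[of A "Psi act B\<mu> A"] B_Psi[of A]
  by (simp add: Qcov_def B_symmetric[of A "Psi act B\<mu> A"])

text \<open>Obtained by bracketing \<open>B\<^sub>\<mu>(\<Psi>(A), A) = 0\<close> with \<open>\<mu>(A)\<close>.\<close>

lemma mu_Psi: "mu B\<mu> (Psi act B\<mu> A) = scale_m (- Qcov act \<omega> B\<mu> A) (mu B\<mu> A)"
proof -
  let ?P = "Psi act B\<mu> A"
  have "bracket (mu B\<mu> A) (B\<mu> ?P A) = B\<mu> (scale_V (Qcov act \<omega> B\<mu> A) A) A + mu B\<mu> ?P"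
    by (subst B_equivariant)
      (simp add: act_mu_Psi mu_def[of B\<mu> ?P], simp add: Psi_def)
  moreover have "bracket (mu B\<mu> A) (B\<mu> ?P A) = 0"
    using B_Psi[of A] bracket_simps(4)[of "mu B\<mu> A" 0 0] by simp
  ultimately show ?thesis
    by (simp add: B_simps mu_def eq_neg_iff_add_eq_0 add.commute)
qed

lemma mu_pencil:
  "mu B\<mu> (scale_V x A + scale_V y (Psi act B\<mu> A))
     = scale_m (x\<^sup>2 - Qcov act \<omega> B\<mu> A * y\<^sup>2) (mu B\<mu> A)"
proof -
  have "mu B\<mu> (scale_V x A + scale_V y (Psi act B\<mu> A))
      = scale_m (x\<^sup>2) (mu B\<mu> A) + scale_m (y\<^sup>2) (mu B\<mu> (Psi act B\<mu> A))"
    by (simp add: mu_def B_simps B_Psi B_symmetric[of A "Psi act B\<mu> A"] power2_eq_square)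
  also have "\<dots> = scale_m (x\<^sup>2 + y\<^sup>2 * - Qcov act \<omega> B\<mu> A) (mu B\<mu> A)"
    unfolding mu_Psi M.scale_left_distrib M.scale_scale ..
  finally show ?thesis by (simp add: mult.commute)
qed

text \<open>Put \<open>n = B\<^sub>\<mu>(A, A')\<close> and \<open>a = \<omega>(A, A')\<close>. Computing the common value \<open>m\<close> of \<open>\<mu>\<close> from either
  argument, \<open>m A' = n A + (3/2) a A\<close> and \<open>m A = n A' - (3/2) a A'\<close>. Inserting both in
  \<open>\<omega>(n A, A') + \<omega>(A, n A') = 0\<close>, the terms in \<open>a\<^sup>2\<close> cancel and what remains compares
  \<open>\<omega>(A, \<Psi>(A))\<close> with \<open>\<omega>(A', \<Psi>(A'))\<close>.\<close>

lemma Qcov_eq_if_mu_eq: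
  assumes "mu B\<mu> A' = mu B\<mu> A"
  shows "Qcov act \<omega> B\<mu> A' = Qcov act \<omega> B\<mu> A"
proof -
  let ?n = "B\<mu> A A'" and ?a = "\<omega> A A'"
  have 1: "act ?n A = Psi act B\<mu> A' - scale_V (3/2 * ?a) A"
    using act_mu[of A A'] assms by (simp add: Psi_def)
  have "act ?n A' = Psi act B\<mu> A - scale_V (3/2 * \<omega> A' A) A'"
    using act_mu[of A' A] assms by (simp add: Psi_def B_symmetric)
  then have 2: "act ?n A' = Psi act B\<mu> A + scale_V (3/2 * ?a) A'"
    by (simp add: form_antisym[of A' A])
  have "act ?n A + scale_V (3/2 * ?a) A = Psi act B\<mu> A'"
    using 1 by simp
  then have "\<omega> (act ?n A) A' + 3/2 * ?a * ?a = - \<omega> A' (Psi act B\<mu> A')"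
    by (metis form_simps(1,3) form_antisym)
  moreover have "\<omega> A (act ?n A') = \<omega> A (Psi act B\<mu> A) + 3/2 * ?a * ?a"
    using 2 by (simp add: form_simps)
  moreover have "\<omega> A (act ?n A') = - \<omega> (act ?n A) A'"
    by (rule form_skew)
  ultimately have "- \<omega> A (Psi act B\<mu> A) = - \<omega> A' (Psi act B\<mu> A')"
    by (metis add_diff_cancel_right' minus_add_distrib minus_minus diff_conv_add_uminus)
  then have "\<omega> A (Psi act B\<mu> A) = \<omega> A' (Psi act B\<mu> A')"
    by simp
  then show ?thesis by (simp add: Qcov_def)
qed

text \<open>With \<open>m = \<mu>(A)\<close> and \<open>n = B\<^sub>\<mu>(A, Z)\<close>, equivariance evaluates both \<open>[m, n]\<close> (through \<open>n\<close>) and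
  \<open>[n, m]\<close> (through \<open>m\<close>). That the two results are opposite is a relation
  which neither computation contains by itself.\<close>

lemma commutator_cancellation:
  "B\<mu> (Psi act B\<mu> A) Z + scale_m 3 (B\<mu> A (act (mu B\<mu> A) Z)) = scale_m (3 * \<omega> A Z) (mu B\<mu> A)"
proof -
  let ?m = "mu B\<mu> A" and ?n = "B\<mu> A Z"
  have nA: "act ?n A + scale_V (3/2 * \<omega> A Z) A = act ?m Z"
    using act_mu[of A Z] by simp
  have "B\<mu> (act ?n A) A + scale_m (3/2 * \<omega> A Z) ?m = B\<mu> (act ?m Z) A"
    unfolding nA[symmetric] by (simp only: B_simps) (simp add: mu_def)
  then have "bracket ?n ?m + scale_m (3 * \<omega> A Z) ?m = scale_m 2 (B\<mu> (act ?m Z) A)"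
    unfolding bracket_mu using two by (auto simp flip: \<open>_ = B\<mu> (act ?m Z) A\<close> simp: M.scale_right_distrib)
  moreover have "bracket ?m ?n = B\<mu> (Psi act B\<mu> A) Z + B\<mu> A (act ?m Z)"
    by (simp add: B_equivariant Psi_def)
  moreover have "scale_m 3 (B\<mu> A (act ?m Z))
      = scale_m 2 (B\<mu> (act ?m Z) A) + B\<mu> A (act ?m Z)"
    using M.scale_left_distrib[of 2 1] by (simp add: B_symmetric)
  ultimately show ?thesis
    using bracket_antisym[of ?n ?m] by (simp add: algebra_simps)
qed

context
  assumes three: "(3 :: 'k) \<noteq> 0"
begin

lemma six_nonzero: "(6 :: 'k) \<noteq> 0"
proof -
  have "(6 :: 'k) = 2 * 3" by simp
  then show ?thesis using two three by (metis mult_eq_0_iff)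
qed

lemma form_Psi: "\<omega> A (Psi act B\<mu> A) = 2/3 * Qcov act \<omega> B\<mu> A"
  using two three six_nonzero by (simp add: Qcov_def)

text \<open>The special identity for the orthogonal pair \<open>\<Psi>(A)\<close>, \<open>A\<close>, whose first term vanishes.\<close>

lemma act_B_Psi:
  "act (B\<mu> (Psi act B\<mu> A) Z) A
     = - scale_V (\<omega> A Z) (Psi act B\<mu> A) - scale_V (Qcov act \<omega> B\<mu> A / 3) Z
       - scale_V (\<omega> (Psi act B\<mu> A) Z / 2) A"
proof -
  let ?P = "Psi act B\<mu> A"
  have e: "\<omega> ?P A / 2 = - (Qcov act \<omega> B\<mu> A / 3)"
    using two three six_nonzero by (simp add: form_antisym[of ?P A] form_Psi field_simps)
  show ?thesis
    using special_halved[of ?P A Z] unfolding B_Psi e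
    by (simp add: algebra_simps eq_neg_iff_add_eq_0)
qed

text \<open>The relation of \<open>commutator_cancellation\<close>, applied to \<open>A\<close>: its second term becomes
  \<open>m\<^sup>2 Z\<close> up to a multiple of \<open>A\<close>, and its first is known from \<open>act_B_Psi\<close>.\<close>

lemma act_mu_squared:
  "scale_V 9 (act (mu B\<mu> A) (act (mu B\<mu> A) Z))
     = scale_V (Qcov act \<omega> B\<mu> A) Z + scale_V (12 * \<omega> A Z) (Psi act B\<mu> A)
       - scale_V (12 * \<omega> (Psi act B\<mu> A) Z) A"
proof -
  let ?P = "Psi act B\<mu> A" and ?m = "mu B\<mu> A" and ?Q = "Qcov act \<omega> B\<mu> A"
  let ?a = "\<omega> A Z" and ?p = "\<omega> (Psi act B\<mu> A) Z"
  have "\<omega> A (act ?m Z) = - ?p"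
    by (simp add: form_skew Psi_def)
  then have m2: "act (B\<mu> A (act ?m Z)) A = act ?m (act ?m Z) + scale_V (3/2 * ?p) A"
    using act_mu[of A "act ?m Z"] by simp
  have "act (B\<mu> ?P Z) A + scale_V 3 (act (B\<mu> A (act ?m Z)) A) = scale_V (3 * ?a) ?P"
    using commutator_cancellation[of A Z] by (metis act_simps(1,3) Psi_def)
  then have "scale_V 3 (act ?m (act ?m Z))
     = scale_V (3 * ?a) ?P - act (B\<mu> ?P Z) A - scale_V (9/2 * ?p) A"
    by (simp add: m2 V.scale_right_distrib algebra_simps)
  also have "\<dots> = scale_V (?Q / 3) Z + (scale_V (3 * ?a) ?P + scale_V ?a ?P)
      - (scale_V (9/2 * ?p) A - scale_V (?p / 2) A)"
    unfolding act_B_Psi by (simp add: algebra_simps)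
  also have "\<dots> = scale_V (?Q / 3) Z + scale_V (4 * ?a) ?P - scale_V (4 * ?p) A"
  proof -
    have "9/2 * ?p - ?p / 2 = 4 * ?p" using two by (simp add: field_simps)
    moreover have "3 * ?a + ?a = 4 * ?a" by simp
    ultimately show ?thesis
      by (metis V.scale_left_distrib V.scale_left_diff_distrib)
  qed
  finally have "scale_V 3 (scale_V 3 (act ?m (act ?m Z)))
     = scale_V 3 (scale_V (?Q / 3) Z + scale_V (4 * ?a) ?P - scale_V (4 * ?p) A)"
    by simp
  then show ?thesis
    using three by (simp add: V.scale_right_distrib V.scale_right_diff_distrib mult.assoc)
qed

section \<open>The fibres over the ground field\<close>

theorem mu_fibre:
  assumes Q: "Qcov act \<omega> B\<mu> A \<noteq> 0"
  shows "mu B\<mu> -` {mu B\<mu> A}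
    = {scale_V x A + scale_V y (Psi act B\<mu> A) | x y. x\<^sup>2 - Qcov act \<omega> B\<mu> A * y\<^sup>2 = 1}"
proof (intro equalityI subsetI)
  fix A'
  assume "A' \<in> {scale_V x A + scale_V y (Psi act B\<mu> A) | x y. x\<^sup>2 - Qcov act \<omega> B\<mu> A * y\<^sup>2 = 1}"
  then show "A' \<in> mu B\<mu> -` {mu B\<mu> A}"
    by (auto simp: mu_pencil)
next
  fix A' assume "A' \<in> mu B\<mu> -` {mu B\<mu> A}"
  then have mu: "mu B\<mu> A' = mu B\<mu> A" by simp
  let ?P = "Psi act B\<mu> A" and ?m = "mu B\<mu> A" and ?Q = "Qcov act \<omega> B\<mu> A"
  have "act ?m (act ?m A') = scale_V ?Q A'"
    using act_mu_Psi[of A'] mu Qcov_eq_if_mu_eq[OF mu] by (simp add: Psi_def)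
  then have "scale_V (9 * ?Q) A' - scale_V ?Q A'
      = scale_V (12 * \<omega> A A') ?P - scale_V (12 * \<omega> ?P A') A"
    using act_mu_squared[of A A'] by simp
  then have 8: "scale_V (8 * ?Q) A' = scale_V (12 * \<omega> A A') ?P - scale_V (12 * \<omega> ?P A') A"
    by (simp flip: V.scale_left_diff_distrib)
  \<comment> \<open>As \<open>8\<close> is a power of \<open>2\<close>, dividing by \<open>8 Q\<close> is possible; it gives the coordinates of \<open>A'\<close>.\<close>
  have "(8 :: 'k) = 2 ^ 3" by simp
  then have "8 * ?Q \<noteq> 0" using Q two by (metis mult_eq_0_iff power_not_zero)
  define x where "x = - (12 * \<omega> ?P A' / (8 * ?Q))"
  define y where "y = 12 * \<omega> A A' / (8 * ?Q)"
  have "A' = scale_V (1 / (8 * ?Q)) (scale_V (8 * ?Q) A')"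
    using \<open>8 * ?Q \<noteq> 0\<close> by simp
  then have A': "A' = scale_V x A + scale_V y ?P"
    unfolding 8 by (simp add: V.scale_right_diff_distrib x_def y_def)
  have "?m \<noteq> 0"
    using Q by (auto simp: Qcov_def Psi_def form_simps(4)[of A 0 0, simplified])
  moreover have "scale_m (x\<^sup>2 - ?Q * y\<^sup>2) ?m = scale_m 1 ?m"
    using mu A' mu_pencil by simp
  ultimately have "x\<^sup>2 - ?Q * y\<^sup>2 = 1"
    using M.scale_right_imp_eq by blast
  then show "A' \<in> {scale_V x A + scale_V y ?P | x y. x\<^sup>2 - ?Q * y\<^sup>2 = 1}"
    using A' by blast
qed

text \<open>\<open>B\<close> and \<open>C\<close> are eigenvectors of \<open>\<mu>(B + C) = 2 B\<^sub>\<mu>(B, C)\<close> with eigenvalues \<open>- 3 \<omega>(B, C)\<close> and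
  \<open>3 \<omega>(B, C)\<close>, so \<open>x (B + C) + y \<Psi>\<close> has the coordinates \<open>x - 3 \<omega>(B, C) y\<close> and \<open>x + 3 \<omega>(B, C) y\<close>
  with respect to them. Their product is the norm form.\<close>

theorem mu_fibre_split:
  assumes mu: "mu B\<mu> B = 0" "mu B\<mu> C = 0" and b: "\<omega> B C \<noteq> 0"
  shows "mu B\<mu> -` {mu B\<mu> (B + C)} = {scale_V u B + scale_V (1 / u) C | u. u \<noteq> 0}"
proof -
  let ?b = "\<omega> B C" and ?A = "B + C" and ?P = "Psi act B\<mu> (B + C)"
  have B: "act (B\<mu> B C) B = - scale_V (3/2 * ?b) B"
    using act_mu[of B C] mu by (simp add: eq_neg_iff_add_eq_0)
  have C: "act (B\<mu> B C) C = scale_V (3/2 * ?b) C"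
    using act_mu[of C B] mu by (simp add: eq_neg_iff_add_eq_0 B_symmetric[of C B] form_antisym[of C B])
  have m: "mu B\<mu> ?A = scale_m 2 (B\<mu> B C)"
    using mu M.scale_left_distrib[of 1 1 "B\<mu> B C"] by (simp add: mu_def B_simps B_symmetric[of C B])
  have P: "?P = scale_V (3 * ?b) C - scale_V (3 * ?b) B"
  proof -
    have "2 * (3/2 * ?b) = 3 * ?b" using two by (simp add: field_simps)
    then have "scale_V 2 (scale_V (3/2 * ?b) X) = scale_V (3 * ?b) X" for X
      by (simp only: V.scale_scale)
    then show ?thesis
      unfolding Psi_def m
      by (simp only: act_simps B C V.scale_right_distrib V.scale_minus_right) simp
  qed
  \<comment> \<open>The same without subtraction, so that the bilinear expansion rules apply.\<close>
  have PP: "?P = scale_V (3 * ?b) C + scale_V (- (3 * ?b)) B"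
    by (simp add: P)
  have "\<omega> ?A ?P = 6 * ?b * ?b"
    unfolding PP by (simp only: form_simps form_alternating form_antisym[of C B]) (simp add: algebra_simps)
  then have Q: "Qcov act \<omega> B\<mu> ?A = 9 * ?b\<^sup>2"
    using two by (simp add: Qcov_def power2_eq_square field_simps)
  have pencil: "scale_V x ?A + scale_V y ?P = scale_V (x - 3 * ?b * y) B + scale_V (x + 3 * ?b * y) C" for x y
    by (simp add: P V.scale_right_distrib V.scale_right_diff_distrib V.scale_left_distrib
        V.scale_left_diff_distrib mult_ac)
  have norm: "x\<^sup>2 - 9 * ?b\<^sup>2 * y\<^sup>2 = (x - 3 * ?b * y) * (x + 3 * ?b * y)" for x y
    by (simp add: power2_eq_square algebra_simps)
  have "9 = (3 :: 'k) ^ 2" by simp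
  then have Q0: "Qcov act \<omega> B\<mu> ?A \<noteq> 0"
    unfolding Q using b three by (metis mult_eq_0_iff power_not_zero)
  have fib: "mu B\<mu> -` {mu B\<mu> ?A}
    = {scale_V (x - 3 * ?b * y) B + scale_V (x + 3 * ?b * y) C | x y.
        (x - 3 * ?b * y) * (x + 3 * ?b * y) = 1}"
    unfolding mu_fibre[OF Q0] pencil Q norm ..
  show ?thesis
    unfolding fib
  proof (intro equalityI subsetI; elim CollectE exE conjE)
    fix X x y
    assume "X = scale_V (x - 3 * ?b * y) B + scale_V (x + 3 * ?b * y) C"
      and xy: "(x - 3 * ?b * y) * (x + 3 * ?b * y) = 1"
    moreover have "x + 3 * ?b * y = 1 / (x - 3 * ?b * y)" and "x - 3 * ?b * y \<noteq> 0"
      using xy by (auto simp: divide_simps mult.commute)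
    ultimately show "X \<in> {scale_V u B + scale_V (1 / u) C | u. u \<noteq> 0}"
      by auto
  next
    fix X u assume X: "X = scale_V u B + scale_V (1 / u) C" and "u \<noteq> 0"
    (* The solution of u = x - 3by and 1/u = x + 3by. *)
    define x where "x = (u + 1 / u) / 2"
    define y where "y = (1 / u - u) / (2 * (3 * ?b))"
    have 1: "3 * ?b * y = (1 / u - u) / 2"
      using b two three six_nonzero by (simp add: y_def)
    have u: "u = x - 3 * ?b * y" "1 / u = x + 3 * ?b * y"
      unfolding 1 x_def using two by (simp_all flip: diff_divide_distrib add_divide_distrib)
    show "X \<in> {scale_V (x - 3 * ?b * y) B + scale_V (x + 3 * ?b * y) C | x y.
        (x - 3 * ?b * y) * (x + 3 * ?b * y) = 1}"
    proof (rule CollectI, rule exI[of _ x], rule exI[of _ y])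
      show "X = scale_V (x - 3 * ?b * y) B + scale_V (x + 3 * ?b * y) C \<and>
          (x - 3 * ?b * y) * (x + 3 * ?b * y) = 1"
        unfolding X u[symmetric] using \<open>u \<noteq> 0\<close> by simp
    qed
  qed
qed

end
end
end

section \<open>Tensor products as quotients of free vector spaces\<close>

lemma free_lift_superset:
  assumes "vector_space s" "finite S" "Poly_Mapping.keys f \<subseteq> S"
  shows "free_lift s g f = (\<Sum>a\<in>S. s (Poly_Mapping.lookup f a) (g a))"
  unfolding free_lift_def
proof (rule sum.mono_neutral_left)
  interpret vector_space s by fact
  show "\<forall>a\<in>S - Poly_Mapping.keys f. s (Poly_Mapping.lookup f a) (g a) = 0"
    by (simp add: in_keys_iff)
qed (use assms in auto)

lemma free_lift_single [simp]:
  assumes "vector_space s"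
  shows "free_lift s g (Poly_Mapping.single a c) = s c (g a)"
  using free_lift_superset[OF assms, of "{a}" "Poly_Mapping.single a c" g] by simp

lemma lookup_free_scale [simp]:
  "Poly_Mapping.lookup (free_scale c f) a = c * Poly_Mapping.lookup f a"
  unfolding free_scale_def by (transfer) (simp add: when_def)

lemma vector_space_free_scale: "vector_space (free_scale :: 'k::field \<Rightarrow> _)"
  by unfold_locales (auto intro!: poly_mapping_eqI simp: lookup_add algebra_simps)

lemma free_lift_linear:
  fixes s :: "'k::field \<Rightarrow> 't::ab_group_add \<Rightarrow> 't"
  assumes "vector_space s"
  shows "Vector_Spaces.linear free_scale s (free_lift s g)"
  unfolding Vector_Spaces.linear_iff
proof (intro conjI allI)
  interpret vector_space s by fact
  show "vector_space s" "vector_space (free_scale :: 'k \<Rightarrow> _)"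
    by (fact, rule vector_space_free_scale)
  show "free_lift s g (f + f') = free_lift s g f + free_lift s g f'" for f f'
    using keys_add[of f f']
    by (simp add: free_lift_superset[OF assms, of "Poly_Mapping.keys f \<union> Poly_Mapping.keys f'"]
        lookup_add scale_left_distrib sum.distrib)
  show "free_lift s g (free_scale c f) = s c (free_lift s g f)" for c f
    by (subst (1 2) free_lift_superset[OF assms, of "Poly_Mapping.keys f"])
      (auto simp: scale_sum_right in_keys_iff)
qed

lemma
  fixes s :: "'k::field \<Rightarrow> 't::ab_group_add \<Rightarrow> 't"
  assumes "vector_space s"
  shows free_lift_add: "free_lift s g (f + f') = free_lift s g f + free_lift s g f'"
    and free_lift_diff: "free_lift s g (f - f') = free_lift s g f - free_lift s g f'"
    and free_lift_scale: "free_lift s g (free_scale c f) = s c (free_lift s g f)"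
proof -
  interpret L: Vector_Spaces.linear free_scale s "free_lift s g"
    by (rule free_lift_linear) fact
  show "free_lift s g (f + f') = free_lift s g f + free_lift s g f'" by (rule L.add)
  show "free_lift s g (f - f') = free_lift s g f - free_lift s g f'" by (rule L.diff)
  show "free_lift s g (free_scale c f) = s c (free_lift s g f)" by (rule L.scale)
qed

lemma free_lift_pair:
  assumes "vector_space s"
  shows "free_lift s (\<lambda>(v, w). g v w)
      (Poly_Mapping.single (v, w) 1 + Poly_Mapping.single (v', w') 1) = g v w + g v' w'"
proof -
  interpret vector_space s by fact
  show ?thesis by (simp add: free_lift_add assms)
qed

lemma tensor_relationsI:
  "Poly_Mapping.single (v + v', w) 1 - Poly_Mapping.single (v, w) 1
     - Poly_Mapping.single (v', w) 1 \<in> tensor_relations s1 s2"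
  "Poly_Mapping.single (v, w + w') 1 - Poly_Mapping.single (v, w) 1
     - Poly_Mapping.single (v, w') 1 \<in> tensor_relations s1 s2"
  "Poly_Mapping.single (s1 c v, w) 1 - free_scale c (Poly_Mapping.single (v, w) 1)
     \<in> tensor_relations s1 s2"
  "Poly_Mapping.single (v, s2 c w) 1 - free_scale c (Poly_Mapping.single (v, w) 1)
     \<in> tensor_relations s1 s2"
  unfolding tensor_relations_def Let_def by blast+

lemma tensor_relation_in_span:
  fixes s1 :: "'k::field \<Rightarrow> 'v::ab_group_add \<Rightarrow> 'v" and s2 :: "'k \<Rightarrow> 'w::ab_group_add \<Rightarrow> 'w"
  assumes "r \<in> tensor_relations s1 s2"
  shows "r \<in> module.span free_scale (tensor_relations s1 s2)"
proof -
  interpret F: vector_space "free_scale :: _ \<Rightarrow> _ \<Rightarrow> 'v \<times> 'w \<Rightarrow>\<^sub>0 'k"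
    by (rule vector_space_free_scale)
  show ?thesis using assms by (rule F.span_base)
qed

text \<open>Half of the universal property of the tensor product: a bilinear map factors through the
  quotient by the tensor relations.\<close>

lemma free_lift_tensor_relations:
  fixes s1 :: "'k::field \<Rightarrow> 'v::ab_group_add \<Rightarrow> 'v" and s2 :: "'k \<Rightarrow> 'w::ab_group_add \<Rightarrow> 'w"
  assumes "vector_space s" and bil: "bilinear_over s1 s2 s g"
    and "f \<in> module.span free_scale (tensor_relations s1 s2)"
  shows "free_lift s (\<lambda>(v, w). g v w) f = 0"
proof -
  interpret vector_space s by fact
  interpret F: vector_space "free_scale :: _ \<Rightarrow> _ \<Rightarrow> 'v \<times> 'w \<Rightarrow>\<^sub>0 'k"
    by (rule vector_space_free_scale)
  let ?g = "free_lift s (\<lambda>(v, w). g v w)"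
  note lift = free_lift_add[OF assms(1)] free_lift_diff[OF assms(1)] free_lift_scale[OF assms(1)]
    free_lift_single[OF assms(1)]
  have "r \<in> tensor_relations s1 s2 \<Longrightarrow> ?g r = 0" for r
    by (auto simp: tensor_relations_def Let_def lift bilinear_overD[OF bil])
  then have "tensor_relations s1 s2 \<subseteq> {f. ?g f = 0}" by auto
  moreover have "F.subspace {f. ?g f = 0}"
    by (rule F.subspaceI) (auto simp: lift, simp add: free_lift_def)
  ultimately show ?thesis
    using assms(3) F.span_minimal by blast
qed

context tensor_product
begin

lemma bilinear_pure: "bilinear_over s1 s2 s3 t"
proof -
  note lift = free_lift_add[OF T.vector_space_axioms] free_lift_diff[OF T.vector_space_axioms]
    free_lift_scale[OF T.vector_space_axioms] free_lift_single[OF T.vector_space_axioms]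
  have *: "free_lift s3 (\<lambda>(v, w). t v w) r = 0" if "r \<in> tensor_relations s1 s2" for r
    using tensor_relation_in_span[OF that] unfolding kernel[symmetric] by simp
  have add: "t (v + v') w = t v w + t v' w" "t v (w + w') = t v w + t v w'" for v v' w w'
    using *[OF tensor_relationsI(1), of v v' w] *[OF tensor_relationsI(2), of v w w']
    by (simp_all add: lift diff_diff_eq)
  have scale: "t (s1 c v) w = s3 c (t v w)" "t v (s2 c w) = s3 c (t v w)" for c v w
    using *[OF tensor_relationsI(3), of c v w] *[OF tensor_relationsI(4), of v c w]
    by (simp_all add: lift)
  show ?thesis
    by (simp add: bilinear_over_def Vector_Spaces.linear_iff add scale
        vector_space_axioms W.vector_space_axioms T.vector_space_axioms)
qed

lemmas pure_simps = bilinear_overD[OF bilinear_pure]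

lemma pure_induct:
  assumes "P 0" and "\<And>x v w. P x \<Longrightarrow> P (x + t v w)"
  shows "P x"
proof -
  obtain f where f: "x = free_lift s3 (\<lambda>(v, w). t v w) f"
    using surjective by (metis surjD)
  have "P (\<Sum>a\<in>S. s3 (Poly_Mapping.lookup f a) (case a of (v, w) \<Rightarrow> t v w))" if "finite S" for S
    using that
  proof induction
    case empty
    then show ?case using assms(1) by simp
  next
    case (insert a S)
    obtain v w where a: "a = (v, w)" by (cases a)
    show ?case
      using assms(2)[OF insert.IH, of "s1 (Poly_Mapping.lookup f a) v" w] insert.hyps
      by (simp add: a pure_simps add.commute)
  qed
  then show ?thesis unfolding f free_lift_def by simp
qed

text \<open>Linear independence in a tensor product is tested by bilinear maps. Sums of two pure tensors
  suffice for a quadratic extension.\<close>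

lemma bilinear_zero_if_pure_sum_zero:
  assumes "vector_space s" "bilinear_over s1 s2 s g" and "t v w + t v' w' = 0"
  shows "g v w + g v' w' = 0"
proof -
  have "Poly_Mapping.single (v, w) 1 + Poly_Mapping.single (v', w') 1
      \<in> module.span free_scale (tensor_relations s1 s2)"
    unfolding kernel[symmetric] using assms(3)
    by (simp add: free_lift_pair[OF T.vector_space_axioms])
  from free_lift_tensor_relations[OF assms(1,2) this] show ?thesis
    by (simp add: free_lift_pair[OF assms(1)])
qed

end

section \<open>Quadratic extensions\<close>

locale field_embedding =
  fixes \<iota> :: "'k::field \<Rightarrow> 'l::field"
  assumes hom: "ring_homomorphism \<iota>"
begin

lemma hom_simps [simp]: "\<iota> 1 = 1" "\<iota> (x + y) = \<iota> x + \<iota> y" "\<iota> (x * y) = \<iota> x * \<iota> y"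
  using hom by (simp_all add: ring_homomorphism_def)

lemma hom_zero [simp]: "\<iota> 0 = 0"
proof -
  have "\<iota> 0 = \<iota> 0 + \<iota> 0"
    by (subst hom_simps(2)[symmetric]) (simp only: add_0_left)
  then show ?thesis by (rule add_cancel_right_right[THEN iffD1])
qed

lemma hom_minus [simp]: "\<iota> (- x) = - \<iota> x"
proof -
  have "\<iota> x + \<iota> (- x) = 0"
    by (subst hom_simps(2)[symmetric]) simp
  then show ?thesis by (rule minus_unique[symmetric])
qed

lemma hom_diff [simp]: "\<iota> (x - y) = \<iota> x - \<iota> y"
  by (simp only: diff_conv_add_uminus hom_simps(2) hom_minus)

lemma hom_eq_0_iff [simp]: "\<iota> x = 0 \<longleftrightarrow> x = 0"
proof
  assume "\<iota> x = 0"
  then show "x = 0"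
    using hom_simps(3)[of x "inverse x"] by (cases "x = 0") (simp_all del: hom_simps(3))
qed simp

lemma hom_eq_iff [simp]: "\<iota> x = \<iota> y \<longleftrightarrow> x = y"
  using hom_eq_0_iff[of "x - y"] by (simp only: hom_diff right_minus_eq)

lemma hom_power [simp]: "\<iota> (x ^ n) = \<iota> x ^ n"
  by (induction n) simp_all

end

locale quadratic_extension = field_embedding \<iota>
  for \<iota> :: "'k::field \<Rightarrow> 'l::field" +
  fixes c :: 'k and \<delta> :: 'l
  assumes nonsquare: "c \<noteq> x\<^sup>2"
    and root: "\<delta>\<^sup>2 = \<iota> c"
    and generates: "\<exists>p q. z = \<iota> p + \<iota> q * \<delta>"
begin

lemma coordinates_zero:
  assumes "\<iota> p + \<iota> q * \<delta> = 0"
  shows "p = 0 \<and> q = 0"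
proof (cases "q = 0")
  case False
  have "(\<iota> q * \<delta>)\<^sup>2 = (\<iota> p)\<^sup>2"
    using assms by (metis add_eq_0_iff power2_minus)
  then have "\<iota> (q\<^sup>2 * c) = \<iota> (p\<^sup>2)"
    by (simp add: power_mult_distrib root)
  then have "c = (p / q)\<^sup>2"
    using False by (simp only: hom_eq_iff) (simp add: power_divide field_simps)
  then show ?thesis using nonsquare by blast
qed (use assms in simp)

lemma coordinates_unique:
  assumes "\<iota> p + \<iota> q * \<delta> = \<iota> p' + \<iota> q' * \<delta>"
  shows "p = p' \<and> q = q'"
  using coordinates_zero[of "p - p'" "q - q'"] assms by (simp add: algebra_simps)

definition fst_coord :: "'l \<Rightarrow> 'k" where "fst_coord z = (THE p. \<exists>q. z = \<iota> p + \<iota> q * \<delta>)"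
definition snd_coord :: "'l \<Rightarrow> 'k" where "snd_coord z = (THE q. \<exists>p. z = \<iota> p + \<iota> q * \<delta>)"

lemma coord [simp]:
  "fst_coord (\<iota> p + \<iota> q * \<delta>) = p" "snd_coord (\<iota> p + \<iota> q * \<delta>) = q"
  unfolding fst_coord_def snd_coord_def by (auto dest: coordinates_unique)

lemma coord_simps:
  "fst_coord (z + z') = fst_coord z + fst_coord z'"
  "snd_coord (z + z') = snd_coord z + snd_coord z'"
  "fst_coord (\<iota> a * z) = a * fst_coord z"
  "snd_coord (\<iota> a * z) = a * snd_coord z"
proof -
  obtain p q p' q' where z: "z = \<iota> p + \<iota> q * \<delta>" "z' = \<iota> p' + \<iota> q' * \<delta>"
    using generates by metis
  have "z + z' = \<iota> (p + p') + \<iota> (q + q') * \<delta>" "\<iota> a * z = \<iota> (a * p) + \<iota> (a * q) * \<delta>"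
    by (simp_all add: z algebra_simps)
  then show "fst_coord (z + z') = fst_coord z + fst_coord z'"
    "snd_coord (z + z') = snd_coord z + snd_coord z'"
    "fst_coord (\<iota> a * z) = a * fst_coord z"
    "snd_coord (\<iota> a * z) = a * snd_coord z"
    by (simp_all only: z coord)
qed

end

text \<open>The elements \<open>p + q \<delta>\<close> form a subfield, inverses being found by rationalising with
  \<open>p - q \<delta>\<close>; by minimality of the splitting field it is everything.\<close>

lemma splitting_field_quadratic:
  assumes split: "splitting_field \<iota> [:- c, 0, 1:]" and "c \<noteq> 0" "c \<notin> unit_squares"
  shows "\<exists>\<delta>. quadratic_extension \<iota> c \<delta>"
proof -
  interpret field_embedding \<iota>
    using split by unfold_locales (simp add: splitting_field_def)
  have nonsquare: "c \<noteq> x\<^sup>2" for x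
    using assms(2,3) by (auto simp: unit_squares_def)
  have p: "map_poly \<iota> [:- c, 0, 1:] = [:- \<iota> c, 0, 1:]"
    by (simp add: map_poly_pCons)
  obtain e rs where rs: "[:- \<iota> c, 0, 1:] = smult e (\<Prod>r\<leftarrow>rs. [:- r, 1:])"
    using split p by (auto simp: splitting_field_def)
  have "rs \<noteq> []"
    using rs by auto
  then obtain \<delta> rs' where "rs = \<delta> # rs'" by (cases rs) auto
  then have "poly [:- \<iota> c, 0, 1:] \<delta> = 0"
    unfolding rs by simp
  then have root: "\<delta>\<^sup>2 = \<iota> c"
    by (simp add: power2_eq_square)
  define F where "F = {\<iota> p + \<iota> q * \<delta> | p q. True}"
  have FI: "\<iota> p + \<iota> q * \<delta> \<in> F" for p q by (auto simp: F_def)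
  have \<iota>F: "\<iota> p \<in> F" for p using FI[of p 0] by simp
  have "is_subfield F"
    unfolding is_subfield_def
  proof (intro conjI ballI)
    show "1 \<in> F" using \<iota>F[of 1] by simp
    fix x assume "x \<in> F"
    then obtain p q where x: "x = \<iota> p + \<iota> q * \<delta>" by (auto simp: F_def)
    show "inverse x \<in> F"
    proof (cases "x = 0")
      case False
      define n where "n = p\<^sup>2 - c * q\<^sup>2"
      have n: "x * (\<iota> p - \<iota> q * \<delta>) = \<iota> n"
        by (simp add: x n_def algebra_simps power2_eq_square flip: root)
      have "n \<noteq> 0"
      proof
        assume "n = 0"
        then have "q \<noteq> 0"
          using False x by (auto simp: n_def)
        then have "c = (p / q)\<^sup>2"
          using \<open>n = 0\<close> by (simp add: n_def power_divide field_simps)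
        then show False using nonsquare by blast
      qed
      then have "inverse x = (\<iota> p - \<iota> q * \<delta>) * \<iota> (1 / n)"
      proof -
        have "\<iota> n * \<iota> (1 / n) = 1" using \<open>n \<noteq> 0\<close> by (simp flip: hom_simps(3))
        then have "x * ((\<iota> p - \<iota> q * \<delta>) * \<iota> (1 / n)) = 1"
          by (simp only: n flip: mult.assoc)
        then show ?thesis by (rule inverse_unique)
      qed
      then show ?thesis using FI[of "p * (1/n)" "- q * (1/n)"] by (simp only: hom_simps hom_minus) (simp add: algebra_simps)
    qed (use \<iota>F[of 0] in simp)
    fix y assume "y \<in> F"
    then obtain p' q' where y: "y = \<iota> p' + \<iota> q' * \<delta>" by (auto simp: F_def)
    show "x - y \<in> F"
      using FI[of "p - p'" "q - q'"] by (simp add: x y algebra_simps)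
    show "x * y \<in> F"
      using FI[of "p * p' + c * (q * q')" "p * q' + q * p'"]
      by (simp add: x y algebra_simps power2_eq_square flip: root)
  qed
  moreover have "range \<iota> \<subseteq> F" using \<iota>F by auto
  moreover have "{r. poly (map_poly \<iota> [:- c, 0, 1:]) r = 0} \<subseteq> F"
  proof
    fix r assume "r \<in> {r. poly (map_poly \<iota> [:- c, 0, 1:]) r = 0}"
    then have "r\<^sup>2 = \<delta>\<^sup>2" by (simp add: p root power2_eq_square[of r])
    then have "r = \<delta> \<or> r = - \<delta>" by (simp add: power2_eq_iff)
    then show "r \<in> F" using FI[of 0 1] FI[of 0 "-1"] by auto
  qed
  ultimately have "F = UNIV"
    using split by (simp add: splitting_field_def)
  then have "\<exists>p q. z = \<iota> p + \<iota> q * \<delta>" for z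
    by (force simp: F_def)
  then show ?thesis
    by (intro exI[of _ \<delta>] quadratic_extension.intro quadratic_extension_axioms.intro
        field_embedding_axioms nonsquare root)
qed

section \<open>Base extension along a quadratic extension\<close>

context space_base_extension
begin

lemma pure_scalar: "t v (\<iota> c * z) = t (s c v) z"
  by (simp add: pure_simps)

lemma pure_minus: "t v (- z) = - t v z"
  using pure_simps(2)[of v z "- z"] pure_simps(2)[of v 0 0]
  by (simp add: eq_neg_iff_add_eq_0 add.commute)

lemma pure_zero_left: "t 0 z = 0"
  using pure_simps(1)[of 0 0 z] by simp

lemma quadratic_decomposition:
  assumes "quadratic_extension \<iota> c \<delta>"
  obtains v w where "x = t v 1 + t w \<delta>"
proof -
  interpret quadratic_extension \<iota> c \<delta> by fact
  have "\<exists>v w. x = t v 1 + t w \<delta>"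
  proof (induction x rule: pure_induct)
    case 1
    show ?case by (intro exI[of _ 0]) (simp add: pure_zero_left)
  next
    case (2 x u z)
    then obtain v w where x: "x = t v 1 + t w \<delta>" by blast
    obtain p q where z: "z = \<iota> p * 1 + \<iota> q * \<delta>"
      using generates by force
    have "x + t u z = t (v + s p u) 1 + t (w + s q u) \<delta>"
      unfolding x z pure_simps(2) pure_scalar by (simp only: pure_simps(1)) (simp add: algebra_simps)
    then show ?case by blast
  qed
  then show thesis using that by blast
qed

text \<open>The \<open>k\<close>-bilinear maps that send \<open>(v, z)\<close> to \<open>v\<close> times one of the two coordinates of \<open>z\<close> separate
  the summands.\<close>

lemma quadratic_independence:
  assumes "quadratic_extension \<iota> c \<delta>" and "t v 1 + t w \<delta> = 0"
  shows "v = 0" "w = 0"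
proof -
  interpret quadratic_extension \<iota> c \<delta> by fact
  have coords: "fst_coord 1 = 1" "snd_coord 1 = 0" "fst_coord \<delta> = 0" "snd_coord \<delta> = 1"
    using coord[of 1 0] coord[of 0 1] by simp_all
  have "bilinear_over s (\<lambda>c z. \<iota> c * z) s (\<lambda>v z. s (fst_coord z) v)"
    "bilinear_over s (\<lambda>c z. \<iota> c * z) s (\<lambda>v z. s (snd_coord z) v)"
    by (simp_all add: bilinear_over_def Vector_Spaces.linear_iff vector_space_axioms
        W.vector_space_axioms coord_simps scale_left_distrib scale_right_distrib scale_left_commute)
  note this[THEN bilinear_zero_if_pure_sum_zero[OF vector_space_axioms _ assms(2)]]
  then show "v = 0" "w = 0" by (simp_all add: coords)
qed

lemma quadratic_inject:
  assumes "quadratic_extension \<iota> c \<delta>" and "t v 1 = t w 1"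
  shows "v = w"
proof -
  have eq: "t (v - w) 1 + t 0 \<delta> = 0"
    using pure_simps(1)[of "v - w" w 1] assms(2) by (simp add: pure_zero_left)
  then show ?thesis using quadratic_independence(1)[OF assms(1) eq] by simp
qed

end

context ssr_base_extension
begin

lemmas B'_simps = bilinear_overD[OF B_ext_bilinear]
lemmas form'_simps = bilinear_overD[OF form_ext_bilinear]

text \<open>All the data descend to \<open>V\<close> by writing \<open>B = P + \<delta> R\<close>, after which the description of the fibre
  over the ground field applies. The hypothesis \<open>\<omega>'(B, \<kappa> B) \<noteq> 0\<close> serves twice: \<open>\<omega>'\<close> being
  alternating, it forces \<open>\<sigma>\<close> to move \<open>\<delta>\<close>, and it makes \<open>e = \<omega>(A, R)\<close> nonzero, whence
  \<open>Q(A) = 9 c e\<^sup>2 \<noteq> 0\<close>.\<close>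

theorem mu_fibre_conjugate:
  assumes two: "(2 :: 'k) \<noteq> 0" and three: "(3 :: 'k) \<noteq> 0"
    and quad: "quadratic_extension \<iota> c \<delta>"
    and \<sigma>: "\<sigma> \<in> galois_group \<iota>" and \<kappa>: "conjugation t\<^sub>V \<sigma> \<kappa>"
    and A: "t\<^sub>V A 1 = B + \<kappa> B" and mu: "mu B\<mu>' B = 0" and nonorth: "\<omega>' B (\<kappa> B) \<noteq> 0"
  shows "(\<lambda>A'. t\<^sub>V A' 1) ` (mu B\<mu> -` {mu B\<mu> A})
      = {scale_V' z B + scale_V' (1 / z) (\<kappa> B) | z. z * \<sigma> z = 1}"
proof -
  interpret quadratic_extension \<iota> c \<delta> by fact
  have \<sigma>_simps: "\<sigma> (x + y) = \<sigma> x + \<sigma> y" "\<sigma> (x * y) = \<sigma> x * \<sigma> y" "\<sigma> (\<iota> a) = \<iota> a" "\<sigma> 1 = 1" for x y a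
    using \<sigma> by (auto simp: galois_group_def ring_homomorphism_def)
  have \<kappa>_simps: "\<kappa> (x + y) = \<kappa> x + \<kappa> y" "\<kappa> (t\<^sub>V v z) = t\<^sub>V v (\<sigma> z)" for x y v z
    using \<kappa> by (auto simp: conjugation_def)
  \<comment> \<open>The factor \<open>1\<close> lets \<open>c\<close> move into the first tensor factor and leaves a pure tensor with \<open>1\<close>.\<close>
  have dd: "\<delta> * \<delta> = \<iota> c * 1" using root by (simp add: power2_eq_square)
  obtain P R where B: "B = t\<^sub>V P 1 + t\<^sub>V R \<delta>"
    by (rule V_ext.quadratic_decomposition[OF quad])
  have \<kappa>B: "\<kappa> B = t\<^sub>V P 1 + t\<^sub>V R (\<sigma> \<delta>)"
    by (simp add: B \<kappa>_simps \<sigma>_simps)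
  have form: "\<omega>' B (\<kappa> B) = \<iota> (\<omega> P R) * (\<sigma> \<delta> - \<delta>)"
    unfolding \<kappa>B unfolding B by (simp only: form'_simps form_ext)
      (simp add: form_alternating form_antisym[of R P] algebra_simps)
  have "(\<sigma> \<delta>)\<^sup>2 = \<delta>\<^sup>2"
    using root \<sigma>_simps(2)[of \<delta> \<delta>] \<sigma>_simps(3) by (simp add: power2_eq_square)
  moreover have "\<sigma> \<delta> \<noteq> \<delta>"
    using nonorth form by auto
  ultimately have \<sigma>\<delta>: "\<sigma> \<delta> = - \<delta>"
    by (auto simp: power2_eq_iff)
  have "t\<^sub>V A 1 = t\<^sub>V (P + P) 1"
    unfolding A \<kappa>B \<sigma>\<delta> unfolding B V_ext.pure_minus V_ext.pure_simps(1) by simp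
  then have AP: "A = scale_V 2 P"
    using V_ext.quadratic_inject[OF quad] V.scale_left_distrib[of 1 1 P] by simp
  have "mu B\<mu>' B = t\<^sub>m (mu B\<mu> P + scale_m c (mu B\<mu> R)) 1 + t\<^sub>m (scale_m 2 (B\<mu> P R)) \<delta>"
    unfolding mu_def B using M.scale_left_distrib[of 1 1 "B\<mu> P R"]
    by (simp only: B'_simps B_ext dd m_ext.pure_scalar m_ext.pure_simps(1))
      (simp add: m_ext.pure_simps(1) B_symmetric[of R P])
  with mu have "mu B\<mu> P + scale_m c (mu B\<mu> R) = 0" and "scale_m 2 (B\<mu> P R) = 0"
    by (metis m_ext.quadratic_independence(1)[OF quad], metis m_ext.quadratic_independence(2)[OF quad])
  then have muP: "mu B\<mu> P = - scale_m c (mu B\<mu> R)" and BAR: "B\<mu> A R = 0"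
    using two by (simp_all add: eq_neg_iff_add_eq_0 AP B_simps)
  define e where "e = \<omega> A R"
  have e: "e \<noteq> 0"
    using nonorth form two by (auto simp: e_def AP form_simps)
  have "act (mu B\<mu> R) A = - scale_V (3/2 * e) R"
    using act_mu[OF two, of R A] BAR by (simp add: B_symmetric[of R A] form_antisym[of R A] e_def)
  moreover have "mu B\<mu> A = scale_m (- 4 * c) (mu B\<mu> R)"
    using muP by (simp add: mu_def AP B_simps)
  ultimately have "Psi act B\<mu> A = scale_V (4 * c * (3/2 * e)) R"
    by (simp only: Psi_def act_simps) simp
  moreover have "4 * c * (3/2 * e) = 6 * c * e"
    using two by (simp add: field_simps)
  ultimately have Psi: "Psi act B\<mu> A = scale_V (6 * c * e) R"
    by (simp only:)
  have Q: "Qcov act \<omega> B\<mu> A = (3 * e)\<^sup>2 * c"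
    using two by (simp add: Qcov_def Psi form_simps e_def[symmetric] power2_eq_square field_simps)
  have c: "c \<noteq> 0" using nonsquare[of 0] by simp
  have "Qcov act \<omega> B\<mu> A \<noteq> 0"
    unfolding Q using e three c by (simp only: power_eq_0_iff mult_eq_0_iff) simp
  note fibre = mu_fibre[OF two three this, unfolded Q]
  \<comment> \<open>As \<open>B = A/2 + \<delta> R\<close> and \<open>\<Psi>(A) = 6 c e R\<close>, the scalar \<open>z = x + q \<delta>\<close> of norm one gives
    \<open>z B + (1/z) \<kappa> B = x A + 2 c q R\<close>; so \<open>y\<close> corresponds to \<open>q = 3 e y\<close>.\<close>
  have conj_point: "scale_V' z B + scale_V' (1 / z) (\<kappa> B)
      = t\<^sub>V (scale_V x A + scale_V y (Psi act B\<mu> A)) 1"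
    if z: "z = \<iota> x + \<iota> (3 * e * y) * \<delta>" "z * \<sigma> z = 1" for x y z
  proof -
    have inv: "1 / z = \<sigma> z" using z(2) by (metis inverse_unique inverse_eq_divide)
    have \<sigma>z: "\<sigma> z = \<iota> x - \<iota> (3 * e * y) * \<delta>"
      unfolding z by (simp only: \<sigma>_simps \<sigma>\<delta>) simp
    have scales: "scale_V' z B = t\<^sub>V P z + t\<^sub>V R (z * \<delta>)"
      "scale_V' w (\<kappa> B) = t\<^sub>V P w + t\<^sub>V R (- (w * \<delta>))" for w
      by (simp_all add: B \<kappa>_simps \<sigma>_simps \<sigma>\<delta> V_ext.E.scale_right_distrib V_ext.scale_pure)
    have "scale_V' z B + scale_V' (1 / z) (\<kappa> B)
        = t\<^sub>V P (z + \<sigma> z) + t\<^sub>V R (z * \<delta> + - (\<sigma> z * \<delta>))"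
      unfolding inv scales V_ext.pure_simps(2) by (simp only: add_ac)
    moreover have "z + \<sigma> z = \<iota> (x + x) * 1"
    proof -
      have "a + b + (a - b) = a + a" for a b :: 'l by simp
      then show ?thesis unfolding \<sigma>z by (simp only: z(1) hom_simps mult_1_right)
    qed
    moreover have "z * \<delta> + - (\<sigma> z * \<delta>) = \<iota> (3 * e * y * c + 3 * e * y * c) * 1"
    proof -
      have "z * \<delta> + - (\<sigma> z * \<delta>) = \<iota> (3 * e * y) * (\<delta> * \<delta>) + \<iota> (3 * e * y) * (\<delta> * \<delta>)"
        unfolding \<sigma>z unfolding z(1) by (simp only: algebra_simps) simp
      then show ?thesis unfolding dd hom_simps by simp
    qed
    ultimately have "scale_V' z B + scale_V' (1 / z) (\<kappa> B)
        = t\<^sub>V (scale_V (x + x) P + scale_V (3 * e * y * c + 3 * e * y * c) R) 1"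
      by (simp only: V_ext.pure_scalar V_ext.pure_simps(1))
    also have "scale_V (x + x) P + scale_V (3 * e * y * c + 3 * e * y * c) R
        = scale_V x A + scale_V y (Psi act B\<mu> A)"
    proof -
      have "x + x = x * 2" "3 * e * y * c + 3 * e * y * c = y * (6 * c * e)" by simp_all
      then show ?thesis unfolding Psi by (simp only: AP V.scale_scale)
    qed
    finally show ?thesis .
  qed
  have norm: "z * \<sigma> z = 1 \<longleftrightarrow> x\<^sup>2 - (3 * e)\<^sup>2 * c * y\<^sup>2 = 1"
    if z: "z = \<iota> x + \<iota> (3 * e * y) * \<delta>" for x y z
  proof -
    have "\<sigma> z = \<iota> x - \<iota> (3 * e * y) * \<delta>"
      unfolding z by (simp only: \<sigma>_simps \<sigma>\<delta>) simp
    then have "z * \<sigma> z = (\<iota> x + \<iota> (3 * e * y) * \<delta>) * (\<iota> x - \<iota> (3 * e * y) * \<delta>)"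
      by (simp only: z)
    also have "\<dots> = (\<iota> x)\<^sup>2 - (\<iota> (3 * e * y))\<^sup>2 * \<delta>\<^sup>2"
    proof -
      have "(a + b) * (a - b) = a\<^sup>2 - b\<^sup>2" for a b :: 'l
        by (simp add: power2_eq_square algebra_simps)
      then show ?thesis by (simp only: power_mult_distrib)
    qed
    also have "\<dots> = \<iota> (x\<^sup>2 - (3 * e * y)\<^sup>2 * c)"
      unfolding root by (simp only: hom_diff hom_power hom_simps(3))
    also have "(3 * e * y)\<^sup>2 * c = (3 * e)\<^sup>2 * c * y\<^sup>2"
      by (simp only: power_mult_distrib mult_ac)
    finally show ?thesis
      using hom_eq_iff[of "x\<^sup>2 - (3 * e)\<^sup>2 * c * y\<^sup>2" 1] by (simp only: hom_simps(1))
  qed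
  have coord: "\<exists>x y. z = \<iota> x + \<iota> (3 * e * y) * \<delta>" for z
  proof -
    obtain x y where "z = \<iota> x + \<iota> y * \<delta>" using generates by blast
    then have "z = \<iota> x + \<iota> (3 * e * (y / (3 * e))) * \<delta>"
      using e three by simp
    then show ?thesis by blast
  qed
  show ?thesis
    unfolding fibre
  proof (intro equalityI subsetI)
    fix X assume "X \<in> (\<lambda>A'. t\<^sub>V A' 1) ` {scale_V x A + scale_V y (Psi act B\<mu> A) | x y.
        x\<^sup>2 - (3 * e)\<^sup>2 * c * y\<^sup>2 = 1}"
    then obtain x y where X: "X = t\<^sub>V (scale_V x A + scale_V y (Psi act B\<mu> A)) 1"
      and xy: "x\<^sup>2 - (3 * e)\<^sup>2 * c * y\<^sup>2 = 1" by (elim imageE CollectE exE conjE) auto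
    define z where "z = \<iota> x + \<iota> (3 * e * y) * \<delta>"
    have "z * \<sigma> z = 1"
      using norm[OF z_def] xy by (rule iffD2)
    moreover have "X = scale_V' z B + scale_V' (1 / z) (\<kappa> B)"
      unfolding X by (rule conj_point[OF z_def \<open>z * \<sigma> z = 1\<close>, symmetric])
    ultimately show "X \<in> {scale_V' z B + scale_V' (1 / z) (\<kappa> B) | z. z * \<sigma> z = 1}"
      by (intro CollectI exI conjI)
  next
    fix X assume "X \<in> {scale_V' z B + scale_V' (1 / z) (\<kappa> B) | z. z * \<sigma> z = 1}"
    then obtain z where X: "X = scale_V' z B + scale_V' (1 / z) (\<kappa> B)" and z: "z * \<sigma> z = 1"
      by blast
    obtain x y where xy: "z = \<iota> x + \<iota> (3 * e * y) * \<delta>" using coord by blast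
    show "X \<in> (\<lambda>A'. t\<^sub>V A' 1) ` {scale_V x A + scale_V y (Psi act B\<mu> A) | x y.
        x\<^sup>2 - (3 * e)\<^sup>2 * c * y\<^sup>2 = 1}"
      unfolding X conj_point[OF xy z]
      by (intro imageI CollectI exI conjI, rule refl) (rule iffD1[OF norm[OF xy] z])
  qed
qed

end

theorem corollary4p14:
  fixes scale_m :: "'k::field \<Rightarrow> 'm::ab_group_add \<Rightarrow> 'm"
    and bracket :: "'m \<Rightarrow> 'm \<Rightarrow> 'm"
    and scale_V :: "'k \<Rightarrow> 'v::ab_group_add \<Rightarrow> 'v"
    and act :: "'m \<Rightarrow> 'v \<Rightarrow> 'v"
    and \<omega> :: "'v \<Rightarrow> 'v \<Rightarrow> 'k"
    and B\<mu> :: "'v \<Rightarrow> 'v \<Rightarrow> 'm"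
    and \<iota> :: "'k \<Rightarrow> 'l::field"
    and \<sigma> :: "'l \<Rightarrow> 'l"
    and t\<^sub>m :: "'m \<Rightarrow> 'l \<Rightarrow> 'n::ab_group_add"
    and t\<^sub>V :: "'v \<Rightarrow> 'l \<Rightarrow> 'w::ab_group_add"
    and scale_m' :: "'l \<Rightarrow> 'n \<Rightarrow> 'n"
    and bracket' :: "'n \<Rightarrow> 'n \<Rightarrow> 'n"
    and scale_V' :: "'l \<Rightarrow> 'w \<Rightarrow> 'w"
    and act' :: "'n \<Rightarrow> 'w \<Rightarrow> 'w"
    and \<omega>' :: "'w \<Rightarrow> 'w \<Rightarrow> 'l"
    and B\<mu>' :: "'w \<Rightarrow> 'w \<Rightarrow> 'n"
    and \<kappa> :: "'w \<Rightarrow> 'w"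
  assumes char: "CHAR('k) \<noteq> 2" "CHAR('k) \<noteq> 3"
    and ssr: "special_symplectic_representation scale_m bracket scale_V act \<omega> B\<mu>"
  shows
    "(\<forall>A. Qcov act \<omega> B\<mu> A \<noteq> 0 \<longrightarrow>
       mu B\<mu> -` {mu B\<mu> A} =
         {scale_V x A + scale_V y (Psi act B\<mu> A) | x y. x\<^sup>2 - Qcov act \<omega> B\<mu> A * y\<^sup>2 = 1}) \<and>
     (\<forall>A B C. Qcov act \<omega> B\<mu> A \<in> unit_squares \<and> A = B + C \<and>
         mu B\<mu> B = 0 \<and> mu B\<mu> C = 0 \<and> \<omega> B C \<noteq> 0 \<longrightarrow>
       mu B\<mu> -` {mu B\<mu> A} = {scale_V u B + scale_V (1 / u) C | u. u \<noteq> 0}) \<and>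
     (\<forall>c A B. c \<noteq> 0 \<and> c \<notin> unit_squares \<and>
         Qcov act \<omega> B\<mu> A \<in> {c * s | s. s \<in> unit_squares} \<and>
         splitting_field \<iota> [:- c, 0, 1:] \<and> galois_generator \<iota> \<sigma> \<and>
         ssr_base_extension scale_m bracket scale_V act \<omega> B\<mu> \<iota> t\<^sub>m t\<^sub>V
           scale_m' bracket' scale_V' act' \<omega>' B\<mu>' \<and>
         conjugation t\<^sub>V \<sigma> \<kappa> \<and>
         t\<^sub>V A 1 = B + \<kappa> B \<and> mu B\<mu>' B = 0 \<and> \<omega>' B (\<kappa> B) \<noteq> 0 \<longrightarrow>
       (\<lambda>A'. t\<^sub>V A' 1) ` (mu B\<mu> -` {mu B\<mu> A}) =
         {scale_V' z B + scale_V' (1 / z) (\<kappa> B) | z. z * \<sigma> z = 1})"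
proof (intro conjI allI impI, goal_cases)
  interpret special_symplectic_representation scale_m bracket scale_V act \<omega> B\<mu>
    by (rule ssr)
  note char' = numerals_nonzero_if_char[OF char]
  {
    case (1 A)
    then show ?case by (rule mu_fibre[OF char'])
  next
    case (2 A B C)
    then show ?case using mu_fibre_split[OF char', of B C] by blast
  next
    case (3 c A B)
    interpret ext: ssr_base_extension scale_m bracket scale_V act \<omega> B\<mu> \<iota> t\<^sub>m t\<^sub>V
        scale_m' bracket' scale_V' act' \<omega>' B\<mu>'
      using 3 by blast
    obtain \<delta> where "quadratic_extension \<iota> c \<delta>"
      using splitting_field_quadratic 3 by blast
    then show ?case
      using ext.mu_fibre_conjugate[OF char'] 3 by (auto simp: galois_generator_def)
  }
qed

end
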